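(* Let $m\le n$ and let $Q\in\mathbb{R}^{m\times n}$ satisfy $QQ^T=I$. If $Q$ has the strong inner product property, then the number of zero entries of $Q$ is at most $nm-\frac12 m(m+1)$.
   Context: All matrices are real; $\circ$ denotes the Hadamard product. A matrix $M\in\mathbb{R}^{m\times n}$ with $m\le n$ has the strong inner product property (SIPP) if $M$ has rank $m$ and $X=O$ is the only symmetric $m\times m$ matrix $X$ with $(XM)\circ M=O$. *)

theory Defs
  imports "HOL-Analysis.Analysis"
begin

definition hadamard_prod :: "real^'n^'m \<Rightarrow> real^'n^'m \<Rightarrow> real^'n^'m"
  (infixl "\<circ>\<^sub>H" 70) where
  "A \<circ>\<^sub>H B = (\<chi> i j. A $ i $ j * B $ i $ j)"

(* An m x n matrix has type real^'n^'m, so m = CARD('m) and n = CARD('n);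
   the rank condition already forces m \<le> n. *)
definition SIPP :: "real^'n^'m \<Rightarrow> bool" where
  "SIPP M \<longleftrightarrow> rank M = CARD('m) \<and>
     (\<forall>X :: real^'m^'m. transpose X = X \<and> (X ** M) \<circ>\<^sub>H M = 0 \<longrightarrow> X = 0)"

end

theory Submission
  imports Defs
begin

text \<open>
  The linear map \<open>X \<mapsto> (XQ) \<circ> Q\<close> sends symmetric matrices to matrices supported on the nonzero
  entries of \<open>Q\<close>, and the strong inner product property says that it is injective. Comparing
  dimensions, \<open>Q\<close> has at least \<open>m(m+1)/2\<close> nonzero entries. Symmetric matrices are parametrised
  as \<open>U + U\<^sup>T\<close> with \<open>U\<close> upper triangular, so that both dimensions are those of spaces of
  matrices with prescribed support.
\<close>

lemma dim_matrices_supported_on: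
  fixes P :: "('m::finite \<times> 'n::finite) set"
  shows "dim {A :: real^'n^'m. \<forall>i j. (i, j) \<notin> P \<longrightarrow> A $ i $ j = 0} = card P"
proof -
  define e :: "'m \<times> 'n \<Rightarrow> real^'n^'m" where "e = (\<lambda>(i, j). axis i (axis j 1))"
  have "inj e"
    by (auto simp: inj_on_def e_def axis_eq_axis)
  have Basis: "Basis = range e"
    by (auto simp: Basis_vec_def e_def)
  have "{A :: real^'n^'m. \<forall>i j. (i, j) \<notin> P \<longrightarrow> A $ i $ j = 0}
      = {A. \<forall>b\<in>Basis. b \<notin> e ` P \<longrightarrow> A \<bullet> b = 0}"
    unfolding Basis using \<open>inj e\<close>
    by (simp add: inj_image_mem_iff) (simp add: e_def inner_axis)
  also have "dim \<dots> = card (e ` P)"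
    by (rule dim_substandard) (auto simp: Basis)
  also have "\<dots> = card P"
    using \<open>inj e\<close> by (simp add: card_image inj_on_subset)
  finally show ?thesis .
qed

text \<open>The pairs and their swaps cover all positions and, by injectivity of \<open>f\<close>,
  overlap exactly in the diagonal; inclusion-exclusion then gives m^2 + m.\<close>

lemma card_inj_le_pairs:
  fixes f :: "'m::finite \<Rightarrow> nat"
  assumes "inj f"
  shows "2 * card {(i, j). f i \<le> f j} = CARD('m) * (CARD('m) + 1)"
proof -
  let ?P = "{(i, j). f i \<le> f j}"
  have un: "?P \<union> prod.swap ` ?P = UNIV"
    by (force simp: image_iff)
  have int: "?P \<inter> prod.swap ` ?P = (\<lambda>i. (i, i)) ` UNIV"
    using injD[OF assms] by (force simp: image_iff)
  have "card ?P + card (prod.swap ` ?P) = CARD('m \<times> 'm) + card ((\<lambda>i::'m. (i, i)) ` UNIV)"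
    by (simp only: card_Un_Int[of ?P "prod.swap ` ?P", simplified] un int)
  moreover have "card (prod.swap ` ?P) = card ?P"
    by (intro card_image) auto
  moreover have "card ((\<lambda>i::'m. (i, i)) ` UNIV) = CARD('m)"
    by (intro card_image) (auto simp: inj_on_def)
  ultimately show ?thesis
    by simp
qed

lemma SIPP_card_nonzero_ge:
  fixes Q :: "real^'n^'m"
  assumes "SIPP Q"
  shows "CARD('m) * (CARD('m) + 1) \<le> 2 * card {(i, j). Q $ i $ j \<noteq> 0}"
proof -
  \<comment> \<open>The index type carries no order; an injection into the naturals supplies one, so
    that \<open>U\<close> can serve as the upper triangular matrices.\<close>
  obtain f :: "'m \<Rightarrow> nat" where f: "inj f"
    using finite_imp_inj_to_nat_seg[of "UNIV :: 'm set"] by auto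
  define U where "U = {A :: real^'m^'m. \<forall>i j. (i, j) \<notin> {(i, j). f i \<le> f j} \<longrightarrow> A $ i $ j = 0}"
  define V where "V = {A :: real^'n^'m. \<forall>i j. (i, j) \<notin> {(i, j). Q $ i $ j \<noteq> 0} \<longrightarrow> A $ i $ j = 0}"
  define g where "g A = ((A + transpose A) ** Q) \<circ>\<^sub>H Q" for A :: "real^'m^'m"
  have lin: "linear g"
    by (rule linearI)
      (simp_all add: g_def hadamard_prod_def vec_eq_iff matrix_matrix_mult_def transpose_def
        sum_distrib_left sum_distrib_right sum.distrib algebra_simps)
  have sub: "subspace U"
    by (auto simp: U_def subspace_def)
  have ker: "A = 0" if "A \<in> U" "g A = 0" for A
  proof -
    have "transpose (A + transpose A) = A + transpose A"
      by (simp add: transpose_def vec_eq_iff)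
    with assms that(2) have "A + transpose A = 0"
      unfolding SIPP_def g_def by blast
    hence skew: "A $ i $ j + A $ j $ i = 0" for i j
      by (simp add: transpose_def vec_eq_iff)
    \<comment> \<open>Above the diagonal the mirrored entry vanishes, so \<open>skew\<close>
      applies; on it \<open>skew\<close> doubles the entry; below it \<open>A\<close> vanishes by
      membership in \<open>U\<close>.\<close>
    have "A $ i $ j = 0" for i j
    proof (cases "f i < f j")
      case True
      hence "A $ j $ i = 0"
        using that(1) by (simp add: U_def)
      thus ?thesis
        using skew[of i j] by simp
    next
      case False
      show ?thesis
      proof (cases "i = j")
        case True
        thus ?thesis
          using skew[of i i] by simp
      next
        case False
        hence "f i \<noteq> f j"
          using f by (auto dest: injD)
        thus ?thesis
          using that(1) \<open>\<not> f i < f j\<close> by (simp add: U_def)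
      qed
    qed
    thus ?thesis
      by (simp add: vec_eq_iff)
  qed
  have "inj_on g (span U)"
    unfolding span_eq_iff[THEN iffD2, OF sub]
    using linear_inj_on_iff_eq_0[OF lin sub] ker by blast
  hence "dim U = dim (g ` U)"
    using dim_image_eq[OF lin] by simp
  \<comment> \<open>The Hadamard factor \<open>Q\<close> makes \<open>g A\<close> vanish wherever
    \<open>Q\<close> does.\<close>
  also have "\<dots> \<le> dim V"
    by (rule dim_subset) (auto simp: V_def g_def hadamard_prod_def)
  finally have "card {(i, j). f i \<le> f j} \<le> card {(i, j). Q $ i $ j \<noteq> 0}"
    unfolding U_def V_def dim_matrices_supported_on .
  thus ?thesis
    using card_inj_le_pairs[OF f] by linarith
qed

theorem corollary4p6:
  fixes Q :: "real^'n^'m"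
  assumes "CARD('m) \<le> CARD('n)"
    and "Q ** transpose Q = mat 1"
    and "SIPP Q"
  shows "real (card {(i, j). Q $ i $ j = 0})
    \<le> real CARD('n) * real CARD('m) - 1 / 2 * real CARD('m) * (real CARD('m) + 1)"
proof -
  let ?Z = "{(i, j). Q $ i $ j = 0}" and ?N = "{(i, j). Q $ i $ j \<noteq> 0}"
  \<comment> \<open>Zeros and nonzeros partition the nm positions, which turns the lower bound on
    \<open>?N\<close> into an upper bound on \<open>?Z\<close>.\<close>
  have "card ?Z + card ?N = card (?Z \<union> ?N)"
    by (rule card_Un_disjoint[symmetric]) auto
  also have "?Z \<union> ?N = UNIV"
    by auto
  finally have "real (card ?Z) + real (card ?N) = real CARD('n) * real CARD('m)"
    by (simp flip: of_nat_add of_nat_mult)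
  moreover have "real CARD('m) * (real CARD('m) + 1) \<le> 2 * real (card ?N)"
    using of_nat_mono[OF SIPP_card_nonzero_ge[OF assms(3)], where 'a = real]
    by (simp add: algebra_simps)
  ultimately show ?thesis
    by simp
qed

end
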